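(* Let $n\in\mathbb N$ be even. Then $\mathrm{rank}\,IF_n=n+1$.
   Context: $\mathbb N=\{1,2,3,\dots\}$. $X_n=\{1,\dots,n\}$ carries the fence (zigzag) partial order $1<_f 2>_f 3<_f\cdots<_f n$ (the only strict relations are between consecutive integers; odd numbers are minimal, even numbers are maximal). $I_n$ is the symmetric inverse semigroup of all partial injective maps on $X_n$; maps are written on the right and composed left to right. $IF_n$ is the inverse subsemigroup of all $\alpha\in I_n$ such that for all $x,y\in\mathrm{dom}\,\alpha$: $x<_f y$ if and only if $x\alpha<_f y\alpha$. The rank of a semigroup is the minimum cardinality of a set generating it as a semigroup. *)

theory Defs
  imports Main
begin

definition fence_less :: "nat \<Rightarrow> nat \<Rightarrow> nat \<Rightarrow> bool" where
  "fence_less n x y \<longleftrightarrow>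
     x \<in> {1..n} \<and> y \<in> {1..n} \<and> odd x \<and> (y = x + 1 \<or> x = y + 1)"

definition sym_inv :: "nat \<Rightarrow> (nat \<rightharpoonup> nat) set" where
  "sym_inv n = {a. dom a \<subseteq> {1..n} \<and> ran a \<subseteq> {1..n} \<and> inj_on a (dom a)}"

definition IF :: "nat \<Rightarrow> (nat \<rightharpoonup> nat) set" where
  "IF n = {a \<in> sym_inv n. \<forall>x\<in>dom a. \<forall>y\<in>dom a.
             fence_less n x y \<longleftrightarrow> fence_less n (the (a x)) (the (a y))}"

text \<open>Maps act on the right, so the product \<open>a b\<close> applies \<open>a\<close> first.\<close>

definition pmult :: "(nat \<rightharpoonup> nat) \<Rightarrow> (nat \<rightharpoonup> nat) \<Rightarrow> (nat \<rightharpoonup> nat)" where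
  "pmult a b = b \<circ>\<^sub>m a"

text \<open>Closure under products only: neither an identity nor inverses are adjoined.\<close>

inductive_set subsemigroup_gen :: "('a \<Rightarrow> 'a \<Rightarrow> 'a) \<Rightarrow> 'a set \<Rightarrow> 'a set"
  for m :: "'a \<Rightarrow> 'a \<Rightarrow> 'a" and A :: "'a set" where
  base: "a \<in> A \<Longrightarrow> a \<in> subsemigroup_gen m A"
| mult: "\<lbrakk>a \<in> subsemigroup_gen m A; b \<in> subsemigroup_gen m A\<rbrakk>
           \<Longrightarrow> m a b \<in> subsemigroup_gen m A"

text \<open>Meaningful only for finitely generated semigroups (otherwise the \<open>LEAST\<close> is unspecified).\<close>

definition semigroup_rank :: "('a \<Rightarrow> 'a \<Rightarrow> 'a) \<Rightarrow> 'a set \<Rightarrow> nat" where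
  "semigroup_rank m S =
     (LEAST k. \<exists>A. A \<subseteq> S \<and> finite A \<and> card A = k \<and> subsemigroup_gen m A = S)"

text \<open>The semigroup \<open>IF n\<close> is finite and closed under \<open>pmult\<close>, so its rank is attained.\<close>

lemma finite_IF: "finite (IF n)"
proof (rule finite_subset)
  show "IF n \<subseteq> (\<Union>D\<in>Pow {1..n}. {a. dom a = D \<and> ran a \<subseteq> {1..n}})"
    by (auto simp: IF_def sym_inv_def)
  show "finite (\<Union>D\<in>Pow {1..n}. {a. dom a = D \<and> ran a \<subseteq> {1..n}})"
    by (auto intro!: finite_set_of_finite_maps intro: finite_subset)
qed

lemma IF_closed:
  assumes a: "a \<in> IF n" and b: "b \<in> IF n"
  shows "pmult a b \<in> IF n"
proof -
  have ab: "\<exists>v w. a x = Some v \<and> b v = Some w \<and> pmult a b x = Some w"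
    if "x \<in> dom (pmult a b)" for x
    using that by (auto simp: pmult_def map_comp_def split: option.splits)
  have "dom (pmult a b) \<subseteq> {1..n}"
    using ab a unfolding IF_def sym_inv_def by blast
  moreover have "ran (pmult a b) \<subseteq> {1..n}"
  proof
    fix w assume "w \<in> ran (pmult a b)"
    then obtain x where x: "pmult a b x = Some w" by (auto simp: ran_def)
    with ab[of x] have "w \<in> ran b" by (auto simp: ran_def)
    then show "w \<in> {1..n}" using b by (auto simp: IF_def sym_inv_def)
  qed
  moreover have "inj_on (pmult a b) (dom (pmult a b))"
  proof (rule inj_onI)
    fix x y assume x: "x \<in> dom (pmult a b)" and y: "y \<in> dom (pmult a b)"
      and e: "pmult a b x = pmult a b y"
    from ab[OF x] obtain v w where v: "a x = Some v" "b v = Some w" "pmult a b x = Some w" by blast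
    from ab[OF y] obtain v' w' where v': "a y = Some v'" "b v' = Some w'" "pmult a b y = Some w'" by blast
    have inj: "inj_on b (dom b)" "inj_on a (dom a)" using a b by (auto simp: IF_def sym_inv_def)
    have "v = v'" using inj_onD[OF inj(1), of v v'] v v' e by (simp add: domI)
    then show "x = y" using inj_onD[OF inj(2), of x y] v v' by (simp add: domI)
  qed
  moreover have "fence_less n x y \<longleftrightarrow>
      fence_less n (the (pmult a b x)) (the (pmult a b y))"
    if x: "x \<in> dom (pmult a b)" and y: "y \<in> dom (pmult a b)" for x y
  proof -
    from ab[OF x] obtain v w where v: "a x = Some v" "b v = Some w" "pmult a b x = Some w" by blast
    from ab[OF y] obtain v' w' where v': "a y = Some v'" "b v' = Some w'" "pmult a b y = Some w'" by blast
    have IFD: "fence_less n p q \<longleftrightarrow> fence_less n r s"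
      if "c \<in> IF n" "c p = Some r" "c q = Some s" for c p q r s
    proof -
      have "p \<in> dom c" "q \<in> dom c" using that by auto
      then have "fence_less n p q \<longleftrightarrow> fence_less n (the (c p)) (the (c q))"
        using that(1) unfolding IF_def by blast
      then show ?thesis using that by simp
    qed
    have "fence_less n x y \<longleftrightarrow> fence_less n v v'"
      using IFD[OF a v(1) v'(1)] .
    also have "\<dots> \<longleftrightarrow> fence_less n w w'"
      using IFD[OF b v(2) v'(2)] .
    finally show ?thesis using v v' by simp
  qed
  ultimately show ?thesis unfolding IF_def sym_inv_def by blast
qed

lemma IF_rank_attained:
  "\<exists>A. A \<subseteq> IF n \<and> finite A \<and> card A = semigroup_rank pmult (IF n)
       \<and> subsemigroup_gen pmult A = IF n"
proof -
  have "x \<in> IF n" if "x \<in> subsemigroup_gen pmult (IF n)" for x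
    using that by induction (auto intro: IF_closed)
  then have "subsemigroup_gen pmult (IF n) = IF n"
    by (auto intro: subsemigroup_gen.base)
  then have "\<exists>k A. A \<subseteq> IF n \<and> finite A \<and> card A = k \<and> subsemigroup_gen pmult A = IF n"
    using finite_IF by blast
  then show ?thesis unfolding semigroup_rank_def by (rule LeastI_ex)
qed

end

theory Submission
  imports Defs
begin

text \<open>
  For even \<open>n\<close> the only element of full domain is the identity, so every generating set contains,
  for each set \<open>D\<close> among \<open>{1..n}\<close> and \<open>{1..n} - {k}\<close>, an element with domain \<open>D\<close>; this
  is the lower bound. Conversely one map per such domain suffices: for \<open>k\<close> even the reflection of
  the part left of the gap \<open>k\<close>, for \<open>k\<close> odd the reflection of the part right of it, except that
  \<open>k = 2\<close> and \<open>k = n - 1\<close> carry the shift by two that sends \<open>1\<close> to \<open>n\<close>, and its inverse.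
  Conjugating, one can reverse the part of the fence between any two gaps of equal parity (\<open>0\<close> and
  \<open>n + 1\<close> count as gaps), and move a singleton block between two even gaps to the far right.
  An arbitrary \<open>a\<close> is turned into an idempotent by such moves, working from left to right and
  extending the initial segment on which \<open>a\<close> is the identity one block at a time; since the
  generated semigroup is closed under inverses, the moves may be applied on either side of \<open>a\<close>.
\<close>

section \<open>Pointwise description of products and of \<open>IF n\<close>\<close>

lemma pmult_eq_Some: "pmult a b x = Some z \<longleftrightarrow> (\<exists>y. a x = Some y \<and> b y = Some z)"
  by (auto simp: pmult_def map_comp_def split: option.splits)

lemma pmult_assoc: "pmult (pmult a b) c = pmult a (pmult b c)"
  by (auto simp: pmult_def map_comp_def fun_eq_iff split: option.splits)

lemma map_eqI: "(\<And>x y. a x = Some y \<longleftrightarrow> b x = Some y) \<Longrightarrow> a = b"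
  by (metis ext not_None_eq)

lemma IF_iff:
  "a \<in> IF n \<longleftrightarrow>
     (\<forall>x y. a x = Some y \<longrightarrow> x \<in> {1..n} \<and> y \<in> {1..n}) \<and>
     (\<forall>x x' y. a x = Some y \<longrightarrow> a x' = Some y \<longrightarrow> x = x') \<and>
     (\<forall>x x' y y'. a x = Some y \<longrightarrow> a x' = Some y' \<longrightarrow>
        (fence_less n x x' \<longleftrightarrow> fence_less n y y'))"
  (is "_ \<longleftrightarrow> ?R")
proof
  assume a: "a \<in> IF n"
  have "x \<in> {1..n} \<and> y \<in> {1..n}" if "a x = Some y" for x y
    using a that unfolding IF_def sym_inv_def by (auto simp: dom_def ran_def subset_iff)
  moreover have "x = x'" if "a x = Some y" "a x' = Some y" for x x' y
    using a that unfolding IF_def sym_inv_def inj_on_def by (auto simp: dom_def)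
  moreover have "fence_less n x x' \<longleftrightarrow> fence_less n y y'"
    if "a x = Some y" "a x' = Some y'" for x x' y y'
  proof -
    have "x \<in> dom a" "x' \<in> dom a" using that by auto
    then have "fence_less n x x' \<longleftrightarrow> fence_less n (the (a x)) (the (a x'))"
      using a unfolding IF_def by blast
    then show ?thesis using that by simp
  qed
  ultimately show ?R by blast
next
  assume R: ?R
  have "dom a \<subseteq> {1..n}" "ran a \<subseteq> {1..n}" using R by (auto simp: dom_def ran_def)
  moreover have "inj_on a (dom a)"
  proof (rule inj_onI)
    fix x y assume "x \<in> dom a" "y \<in> dom a" "a x = a y"
    then obtain z where "a x = Some z" "a y = Some z" by auto
    then show "x = y" using R by blast
  qed
  moreover have "\<forall>x\<in>dom a. \<forall>y\<in>dom a. fence_less n x y \<longleftrightarrow> fence_less n (the (a x)) (the (a y))"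
  proof (intro ballI)
    fix x y assume "x \<in> dom a" "y \<in> dom a"
    then obtain u v where "a x = Some u" "a y = Some v" by auto
    then show "fence_less n x y \<longleftrightarrow> fence_less n (the (a x)) (the (a y))" using R by simp
  qed
  ultimately show "a \<in> IF n" unfolding IF_def sym_inv_def by blast
qed

text \<open>Comparable points are exactly the adjacent ones, and the parity of the first decides the
  direction. Parities of non-adjacent points may therefore differ, which is what allows an isolated
  point to change parity.\<close>

lemma fence_less_cong:
  assumes "x \<in> {1..n}" "x' \<in> {1..n}" "y \<in> {1..n}" "y' \<in> {1..n}"
    and "(x' = x + 1 \<or> x = x' + 1) \<longleftrightarrow> (y' = y + 1 \<or> y = y' + 1)"
    and "x' = x + 1 \<or> x = x' + 1 \<Longrightarrow> odd x \<longleftrightarrow> odd y"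
  shows "fence_less n x x' \<longleftrightarrow> fence_less n y y'"
  using assms unfolding fence_less_def by blast

lemma IF_I:
  assumes "\<And>x y. a x = Some y \<Longrightarrow> x \<in> {1..n}" "\<And>x y. a x = Some y \<Longrightarrow> y \<in> {1..n}"
    and "\<And>x x' y. a x = Some y \<Longrightarrow> a x' = Some y \<Longrightarrow> x = x'"
    and "\<And>x x' y y'. a x = Some y \<Longrightarrow> a x' = Some y' \<Longrightarrow> fence_less n x x' \<longleftrightarrow> fence_less n y y'"
  shows "a \<in> IF n"
  unfolding IF_iff using assms by blast

lemma IF_range: "a \<in> IF n \<Longrightarrow> a x = Some y \<Longrightarrow> 1 \<le> x \<and> x \<le> n \<and> 1 \<le> y \<and> y \<le> n"
  unfolding IF_iff by (meson atLeastAtMost_iff)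

lemma IF_dom: "a \<in> IF n \<Longrightarrow> dom a \<subseteq> {1..n}"
  by (simp add: IF_def sym_inv_def)

lemma IF_ran: "a \<in> IF n \<Longrightarrow> ran a \<subseteq> {1..n}"
  by (simp add: IF_def sym_inv_def)

lemma IF_inj: "a \<in> IF n \<Longrightarrow> a x = Some y \<Longrightarrow> a x' = Some y \<Longrightarrow> x = x'"
  unfolding IF_iff by blast

lemma IF_fence:
  "a \<in> IF n \<Longrightarrow> a x = Some y \<Longrightarrow> a x' = Some y' \<Longrightarrow> fence_less n x x' \<longleftrightarrow> fence_less n y y'"
  unfolding IF_iff by blast

lemma IF_adjacent:
  assumes "a \<in> IF n" "a x = Some y" "a x' = Some y'"
  shows "(x' = x + 1 \<or> x = x' + 1) \<longleftrightarrow> (y' = y + 1 \<or> y = y' + 1)"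
proof -
  have *: "(u' = u + 1 \<or> u = u' + 1) \<longleftrightarrow> fence_less n u u' \<or> fence_less n u' u"
    if "u \<in> {1..n}" "u' \<in> {1..n}" for u u'
    using that unfolding fence_less_def by auto
  show ?thesis
    using IF_fence[OF assms] IF_fence[OF assms(1,3,2)] IF_range[OF assms(1,2)] IF_range[OF assms(1,3)]
      *[of x x'] *[of y y'] by simp
qed

text \<open>A neighbour in the domain shows whether \<open>x\<close> is the lower or the upper point
  of a comparable pair, that is, whether it is odd or even; the map preserves this.\<close>

lemma IF_parity:
  assumes "a \<in> IF n" "a x = Some y" "a x' = Some y'" "x' = x + 1 \<or> x = x' + 1"
  shows "even x \<longleftrightarrow> even y"
proof -
  have "y' = y + 1 \<or> y = y' + 1"
    using IF_adjacent[OF assms(1-3)] assms(4) by blast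
  then show ?thesis
    using IF_fence[OF assms(1-3)] IF_range[OF assms(1,2)] IF_range[OF assms(1,3)] assms(4)
    unfolding fence_less_def by auto
qed

section \<open>Inverses of partial injections\<close>

definition pinv :: "(nat \<rightharpoonup> nat) \<Rightarrow> (nat \<rightharpoonup> nat)" where
  "pinv a y = (if \<exists>x. a x = Some y then Some (SOME x. a x = Some y) else None)"

lemma pinv_eq_Some:
  assumes "a \<in> IF n"
  shows "pinv a y = Some x \<longleftrightarrow> a x = Some y"
proof (cases "\<exists>x. a x = Some y")
  case True
  then have "a (SOME x. a x = Some y) = Some y" by (rule someI_ex)
  then show ?thesis using True IF_inj[OF assms] by (auto simp: pinv_def)
next
  case False
  then show ?thesis by (simp add: pinv_def)
qed

lemma pinv_IF:
  assumes "a \<in> IF n"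
  shows "pinv a \<in> IF n"
  using assms IF_range[OF assms]
  by (intro IF_I; unfold pinv_eq_Some[OF assms]) (auto simp: IF_fence[OF assms])

lemma pinv_pinv:
  assumes "a \<in> IF n"
  shows "pinv (pinv a) = a"
  by (rule map_eqI) (simp add: pinv_eq_Some[OF assms] pinv_eq_Some[OF pinv_IF[OF assms]])

lemma pinv_pmult:
  assumes "a \<in> IF n" "b \<in> IF n"
  shows "pinv (pmult a b) = pmult (pinv b) (pinv a)"
  by (rule map_eqI)
    (auto simp: pmult_eq_Some pinv_eq_Some[OF IF_closed[OF assms]] pinv_eq_Some[OF assms(1)]
       pinv_eq_Some[OF assms(2)])

lemma ran_pinv: "a \<in> IF n \<Longrightarrow> ran (pinv a) = dom a"
  by (auto simp: ran_def dom_def pinv_eq_Some)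

lemma dom_pinv: "a \<in> IF n \<Longrightarrow> dom (pinv a) = ran a"
  by (auto simp: ran_def dom_def pinv_eq_Some)

section \<open>Blocks of the domain and their images\<close>

text \<open>Consecutive points go to adjacent values, and injectivity forbids turning back, so the
  first step fixes the direction. The conjunct \<open>t < c\<close> keeps the subtraction
  \<open>c - t\<close> from being truncated.\<close>

lemma IF_path:
  assumes a: "a \<in> IF n" and c: "a (Suc m) = Some c"
    and d: "\<And>t. t < k \<Longrightarrow> Suc m + t \<in> dom a"
  shows "(\<forall>t<k. a (Suc m + t) = Some (c + t)) \<or>
         (\<forall>t<k. t < c \<and> a (Suc m + t) = Some (c - t))"
  using d
proof (induction k)
  case 0
  then show ?case by simp
next
  case (Suc k)
  then have IH: "(\<forall>t<k. a (Suc m + t) = Some (c + t)) \<or>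
      (\<forall>t<k. t < c \<and> a (Suc m + t) = Some (c - t))" by simp
  obtain y where y: "a (Suc m + k) = Some y" using Suc.prems[of k] by auto
  have y1: "1 \<le> y" using IF_range[OF a y] by simp
  consider "k = 0" | "k = 1" | j where "k = Suc (Suc j)" by (metis One_nat_def old.nat.exhaust)
  then show ?case
  proof cases
    case 1
    then show ?thesis using c y1 y by auto
  next
    case 2
    then have "y = c + 1 \<or> c = y + 1" using IF_adjacent[OF a c y] by simp
    then show ?thesis using 2 c y y1 by (auto simp: less_Suc_eq)
  next
    case 3
    have ne: "Suc m + k \<noteq> Suc m + j" using 3 by simp
    from IH show ?thesis
    proof
      assume H: "\<forall>t<k. a (Suc m + t) = Some (c + t)"
      have 1: "a (Suc m + Suc j) = Some (c + Suc j)" "a (Suc m + j) = Some (c + j)"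
        using H 3 by auto
      have "y = c + Suc j + 1 \<or> c + Suc j = y + 1"
        using IF_adjacent[OF a 1(1) y] 3 by simp
      moreover have "y \<noteq> c + j" using IF_inj[OF a, of "Suc m + k" y "Suc m + j"] y 1(2) ne by metis
      ultimately have "y = c + k" using 3 by simp
      then show ?thesis using H y by (auto simp: less_Suc_eq)
    next
      assume H: "\<forall>t<k. t < c \<and> a (Suc m + t) = Some (c - t)"
      have 1: "a (Suc m + Suc j) = Some (c - Suc j)" "a (Suc m + j) = Some (c - j)" "Suc j < c"
        using H 3 by auto
      have "y = c - Suc j + 1 \<or> c - Suc j = y + 1"
        using IF_adjacent[OF a 1(1) y] 3 by simp
      moreover have "y \<noteq> c - j" using IF_inj[OF a, of "Suc m + k" y "Suc m + j"] y 1(2) ne by metis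
      ultimately have "y = c - k" "k < c" using 3 1(3) y1 by auto
      then show ?thesis using H y by (auto simp: less_Suc_eq)
    qed
  qed
qed

text \<open>A maximal interval of the domain, encoded by the two gaps around it, since moves are
  described by gaps. For maps in \<open>IF n\<close> the numbers \<open>0\<close> and
  \<open>n + 1\<close> are always gaps.\<close>

definition block :: "(nat \<rightharpoonup> nat) \<Rightarrow> nat \<Rightarrow> nat \<Rightarrow> bool" where
  "block a m q \<longleftrightarrow> m + 1 < q \<and> {m<..<q} \<subseteq> dom a \<and> m \<notin> dom a \<and> q \<notin> dom a"

text \<open>The image of a block is again enclosed by two gaps, now of the range: a value next to
  the image would have its preimage next to the block. The witness \<open>p\<close> is the left one
  of these gaps, and the two alternatives are the two orientations.\<close>

lemma block_image:
  assumes a: "a \<in> IF n" and b: "block a m q"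
  obtains p where "p \<notin> ran a" "p + (q - m) \<notin> ran a" "p + (q - m) \<le> n + 1"
    "(\<forall>x. m < x \<longrightarrow> x < q \<longrightarrow> a x = Some (p + (x - m))) \<or>
     (\<forall>x. m < x \<longrightarrow> x < q \<longrightarrow> a x = Some (p + (q - x)))"
proof -
  have mq: "m + 1 < q" and d: "{m<..<q} \<subseteq> dom a" and md: "m \<notin> dom a" and qd: "q \<notin> dom a"
    using b by (auto simp: block_def)
  obtain c where c: "a (Suc m) = Some c" using d mq by force
  have c1: "1 \<le> c" using IF_range[OF a c] by simp
  define k where "k = q - m - 1"
  have k: "q = Suc m + k" "1 \<le> k" using mq by (auto simp: k_def)
  have "Suc m + t \<in> dom a" if "t < k" for t
    using that k(1) by (intro subsetD[OF d]) simp
  note path = IF_path[OF a c this]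
  \<comment> \<open>Adjacent values have adjacent preimages, and a step of one cannot leave the
    block without hitting \<open>m\<close> or \<open>q\<close>.\<close>
  have inside: "m < z \<and> z < q"
    if "a x = Some y" "m < x" "x < q" "a z = Some w" "w = y + 1 \<or> y = w + 1" for x y z w
  proof -
    have "z = x + 1 \<or> x = z + 1" using IF_adjacent[OF a that(1,4)] that(5) by blast
    moreover have "z \<noteq> m" "z \<noteq> q" using that(4) md qd by auto
    ultimately show ?thesis using that(2,3) by auto
  qed
  have first: "m < Suc m" "Suc m < q" using mq by auto
  have last: "m < m + k" "m + k < q" using k by auto
  show thesis
    using path
  proof
    assume up: "\<forall>t<k. a (Suc m + t) = Some (c + t)"
    have img: "a x = Some (c - 1 + (x - m))" if "m < x" "x < q" for x
      using up[rule_format, of "x - Suc m"] that k c1 by auto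
    have "c - 1 \<notin> ran a"
    proof
      assume "c - 1 \<in> ran a"
      then obtain z where z: "a z = Some (c - 1)" by (auto simp: ran_def)
      have "m < z \<and> z < q" using inside[OF c first z] c1 by simp
      then show False using img[of z] z by auto
    qed
    moreover have "c - 1 + (q - m) \<notin> ran a"
    proof
      assume "c - 1 + (q - m) \<in> ran a"
      then obtain z where z: "a z = Some (c - 1 + (q - m))" by (auto simp: ran_def)
      have "m < z \<and> z < q" using inside[OF img[OF last] last z] k by simp
      then show False using img[of z] z by auto
    qed
    moreover have "c - 1 + (q - m) \<le> n + 1"
      using IF_range[OF a img[OF last]] k by simp
    ultimately show thesis using that[of "c - 1"] img by blast
  next
    assume down: "\<forall>t<k. t < c \<and> a (Suc m + t) = Some (c - t)"
    have kc: "k \<le> c" using down[rule_format, of "k - 1"] k by auto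
    have img: "a x = Some (c - k + (q - x))" if "m < x" "x < q" for x
      using down[rule_format, of "x - Suc m"] that k kc by auto
    have "c - k \<notin> ran a"
    proof
      assume "c - k \<in> ran a"
      then obtain z where z: "a z = Some (c - k)" by (auto simp: ran_def)
      have "m < z \<and> z < q" using inside[OF img[OF last] last z] k by simp
      then show False using img[of z] z by auto
    qed
    moreover have "c - k + (q - m) \<notin> ran a"
    proof
      assume "c - k + (q - m) \<in> ran a"
      then obtain z where z: "a z = Some (c - k + (q - m))" by (auto simp: ran_def)
      have "m < z \<and> z < q" using inside[OF c first z] k kc by simp
      then show False using img[of z] z by auto
    qed
    moreover have "c - k + (q - m) \<le> n + 1"
      using IF_range[OF a c] k kc by simp
    ultimately show thesis using that[of "c - k"] img by blast
  qed
qed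

lemma block_parity:
  assumes a: "a \<in> IF n" and b: "block a m q" and q: "m + 3 \<le> q"
    and x: "m < x" "x < q" "a x = Some y"
  shows "even x \<longleftrightarrow> even y"
proof -
  obtain x' where x': "m < x'" "x' < q" "x' = x + 1 \<or> x = x' + 1"
  proof (cases "x + 1 < q")
    case True
    then show ?thesis using that[of "x + 1"] x by simp
  next
    case False
    then show ?thesis using that[of "x - 1"] x q by simp
  qed
  then obtain y' where "a x' = Some y'" using b unfolding block_def by force
  then show ?thesis using IF_parity[OF a x(3) _ x'(3)] by blast
qed

section \<open>Reflections and slides\<close>

text \<open>Deleting \<open>i\<close> and \<open>j\<close> cuts the points between them off from the
  rest, so they can be reversed while all others stay fixed. The choices \<open>i = 0\<close> and
  \<open>j = n + 1\<close> delete nothing at that end.\<close>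

definition reflect :: "nat \<Rightarrow> nat \<Rightarrow> nat \<Rightarrow> (nat \<rightharpoonup> nat)" where
  "reflect n i j x =
     (if x \<in> {1..n} - {i, j} then Some (if i < x \<and> x < j then i + j - x else x) else None)"

text \<open>The isolated point \<open>p + 1\<close> jumps to the end \<open>n\<close>, and the
  points beyond \<open>p + 2\<close> close up by two, which keeps their parity. In the range the
  missing points are \<open>p\<close> and \<open>n - 1\<close>.\<close>

definition slide :: "nat \<Rightarrow> nat \<Rightarrow> (nat \<rightharpoonup> nat)" where
  "slide n p x =
     (if x \<in> {1..n} - {p, p + 2}
      then Some (if x < p then x else if x = p + 1 then n else x - 2) else None)"

lemma reflect_eq_Some:
  assumes "i \<le> j"
  shows "reflect n i j x = Some y \<longleftrightarrow>
     1 \<le> x \<and> x \<le> n \<and> (i < x \<and> x < j \<and> x + y = i + j \<or> x < i \<and> y = x \<or> j < x \<and> y = x)"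
  using assms by (auto simp: reflect_def)

lemma slide_eq_Some:
  "slide n p x = Some y \<longleftrightarrow>
     1 \<le> x \<and> x \<le> n \<and> (x < p \<and> y = x \<or> x = p + 1 \<and> y = n \<or> p + 2 < x \<and> x = y + 2)"
  by (auto simp: slide_def)

lemma reflect_IF:
  assumes ij: "even (i + j)" "i \<le> j" "j \<le> n + 1"
  shows "reflect n i j \<in> IF n"
proof -
  note S = reflect_eq_Some[OF ij(2)]
  have range: "x \<in> {1..n}" "y \<in> {1..n}" if "reflect n i j x = Some y" for x y
    using ij that unfolding S by auto
  have inj: "x = x'" if "reflect n i j x = Some y" "reflect n i j x' = Some y" for x x' y
    using that unfolding S by auto
  have fence: "fence_less n x x' \<longleftrightarrow> fence_less n y y'"
    if x: "reflect n i j x = Some y" "reflect n i j x' = Some y'" for x x' y y'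
  proof (rule fence_less_cong)
    have *: "i < x \<and> x < j \<and> x + y = i + j \<or> x < i \<and> y = x \<or> j < x \<and> y = x"
      "i < x' \<and> x' < j \<and> x' + y' = i + j \<or> x' < i \<and> y' = x' \<or> j < x' \<and> y' = x'"
      using x unfolding S by blast+
    show "(x' = x + 1 \<or> x = x' + 1) \<longleftrightarrow> (y' = y + 1 \<or> y = y' + 1)"
      \<comment> \<open>Each of the three regions is mapped to itself, and distinct regions are
        separated by a deleted point, so adjacency can only occur within one region.\<close>
      using * by (elim disjE conjE; insert ij; force)
    show "odd x \<longleftrightarrow> odd y"
      using *(1) ij(1) by presburger
  qed (use range[OF x(1)] range[OF x(2)] in auto)
  show ?thesis by (rule IF_I) (fact range inj fence)+
qed

lemma slide_IF:
  assumes p: "p + 2 \<le> n"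
  shows "slide n p \<in> IF n"
proof -
  have range: "x \<in> {1..n}" "y \<in> {1..n}" if "slide n p x = Some y" for x y
    using p that unfolding slide_eq_Some by auto
  have inj: "x = x'" if "slide n p x = Some y" "slide n p x' = Some y" for x x' y
    using p that unfolding slide_eq_Some by auto
  have fence: "fence_less n x x' \<longleftrightarrow> fence_less n y y'"
    if x: "slide n p x = Some y" "slide n p x' = Some y'" for x x' y y'
  proof (rule fence_less_cong)
    have *: "x < p \<and> y = x \<or> x = p + 1 \<and> y = n \<or> p + 2 < x \<and> x = y + 2"
      "x' < p \<and> y' = x' \<or> x' = p + 1 \<and> y' = n \<or> p + 2 < x' \<and> x' = y' + 2" "x \<le> n" "x' \<le> n"
      using x unfolding slide_eq_Some by blast+
    show "(x' = x + 1 \<or> x = x' + 1) \<longleftrightarrow> (y' = y + 1 \<or> y = y' + 1)"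
      using *(1,2) by (elim disjE conjE; insert *(3,4) p; force)
    show "odd x \<longleftrightarrow> odd y" if "x' = x + 1 \<or> x = x' + 1"
      using *(1,2) by (elim disjE conjE; insert *(3,4) p that; force)
  qed (use range[OF x(1)] range[OF x(2)] in auto)
  show ?thesis by (rule IF_I) (fact range inj fence)+
qed

lemma restrict_Some_eq_Some: "(Some |` D) x = Some y \<longleftrightarrow> x \<in> D \<and> y = x"
  by (auto simp: restrict_map_def)

lemma pmult_pinv_right:
  assumes "a \<in> IF n"
  shows "pmult a (pinv a) = Some |` dom a"
  by (rule map_eqI)
    (auto simp: pmult_eq_Some pinv_eq_Some[OF assms] restrict_Some_eq_Some dest: IF_inj[OF assms])

lemma pmult_restrict_Some: "pmult (Some |` D) (Some |` E) = Some |` (D \<inter> E)"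
  by (rule map_eqI) (auto simp: pmult_eq_Some restrict_Some_eq_Some)

lemma pmult_restrict_right:
  assumes "ran a \<subseteq> D"
  shows "pmult a (Some |` D) = a"
  using assms by (intro map_eqI) (auto simp: pmult_eq_Some restrict_Some_eq_Some ran_def)

lemma pinv_reflect:
  assumes "even (i + j)" "i \<le> j" "j \<le> n + 1"
  shows "pinv (reflect n i j) = reflect n i j"
  using assms
  by (intro map_eqI)
    (auto simp: pinv_eq_Some[OF reflect_IF[OF assms]] reflect_eq_Some[OF assms(2)])

lemma dom_reflect: "dom (reflect n i j) = {1..n} - {i, j}"
  by (auto simp: reflect_def dom_def)

lemma dom_slide: "dom (slide n p) = {1..n} - {p, p + 2}"
  by (auto simp: slide_def dom_def)

lemma ran_slide:
  assumes "p + 2 \<le> n"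
  shows "ran (slide n p) = {1..n} - {p, n - 1}"
proof (intro equalityI subsetI)
  fix y assume "y \<in> ran (slide n p)"
  then show "y \<in> {1..n} - {p, n - 1}"
    using assms by (auto simp: ran_def slide_eq_Some)
next
  fix y assume y: "y \<in> {1..n} - {p, n - 1}"
  define x where "x = (if y < p then y else if y = n then p + 1 else y + 2)"
  have "slide n p x = Some y"
    using y assms unfolding slide_eq_Some x_def by auto
  then show "y \<in> ran (slide n p)" by (rule ranI)
qed

section \<open>Conjugation identities\<close>

text \<open>Lets a product be evaluated only at the points where the simpler map \<open>a\<close> is
  defined; elsewhere a comparison of domains is enough.\<close>

lemma map_eq_leI:
  assumes "\<And>x y. a x = Some y \<Longrightarrow> b x = Some y" "dom b \<subseteq> dom a"
  shows "a = b"
proof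
  fix x show "a x = b x"
    using assms(1)[of x] assms(2) by (cases "a x"; cases "b x") auto
qed

lemma pmult3I: "a x = Some u \<Longrightarrow> b u = Some v \<Longrightarrow> c v = Some w \<Longrightarrow> pmult (pmult a b) c x = Some w"
  by (auto simp: pmult_eq_Some)

lemma dom_pmult3:
  "(\<And>u. a x = Some u \<Longrightarrow> b u \<noteq> None \<Longrightarrow> x \<in> D) \<Longrightarrow> x \<in> dom (pmult (pmult a b) c) \<Longrightarrow> x \<in> D"
  by (auto simp: pmult_eq_Some)

text \<open>Reflecting the first \<open>j\<close> places turns the segment between \<open>i\<close>
  and \<open>j\<close> into the initial segment before \<open>j - i\<close>; it is reversed there
  and carried back. The points left of \<open>i\<close> are moved beyond \<open>j - i\<close>, stay
  fixed, and return.\<close>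

lemma reflect_conj_left:
  assumes ij: "i \<le> j" "j \<le> n"
  shows "reflect n i j = pmult (pmult (reflect n 0 j) (reflect n 0 (j - i))) (reflect n 0 j)"
proof (rule map_eq_leI)
  fix x y assume "reflect n i j x = Some y"
  then have xn: "1 \<le> x" "x \<le> n"
    and "i < x \<and> x < j \<and> x + y = i + j \<or> x < i \<and> y = x \<or> j < x \<and> y = x"
    by (simp_all add: reflect_eq_Some[OF ij(1)])
  then consider "i < x" "x < j" "x + y = i + j" | "x < i" "y = x" | "j < x" "y = x" by blast
  then show "pmult (pmult (reflect n 0 j) (reflect n 0 (j - i))) (reflect n 0 j) x = Some y"
  proof cases
    case 1
    then show ?thesis
      using ij xn by (intro pmult3I[of _ _ "j - x" _ "x - i"]) (auto simp: reflect_eq_Some)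
  next
    case 2
    then show ?thesis
      using ij xn by (intro pmult3I[of _ _ "j - x" _ "j - x"]) (auto simp: reflect_eq_Some)
  next
    case 3
    then show ?thesis
      using ij xn by (intro pmult3I[of _ _ x _ x]) (auto simp: reflect_eq_Some)
  qed
next
  show "dom (pmult (pmult (reflect n 0 j) (reflect n 0 (j - i))) (reflect n 0 j)) \<subseteq> dom (reflect n i j)"
  proof (rule subsetI, erule dom_pmult3[rotated])
    fix x u assume "reflect n 0 j x = Some u" "reflect n 0 (j - i) u \<noteq> None"
    then show "x \<in> dom (reflect n i j)"
      using ij by (auto simp: reflect_def split: if_splits)
  qed
qed
text \<open>The mirror image of the previous identity: the segment is carried to the right end of
  the fence, reversed there, and carried back.\<close>

lemma reflect_conj_right:
  assumes ij: "i \<le> j" "j \<le> n + 1" "odd i"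
  shows "reflect n i j = pmult (pmult (reflect n i (n+1)) (reflect n (n + 1 + i - j) (n + 1))) (reflect n i (n + 1))"
proof (rule map_eq_leI)
  fix x y assume "reflect n i j x = Some y"
  then have xn: "1 \<le> x" "x \<le> n"
    and "i < x \<and> x < j \<and> x + y = i + j \<or> x < i \<and> y = x \<or> j < x \<and> y = x"
    by (simp_all add: reflect_eq_Some[OF ij(1)])
  then consider "i < x" "x < j" "x + y = i + j" | "x < i" "y = x" | "j < x" "y = x" by blast
  then show "pmult (pmult (reflect n i (n+1)) (reflect n (n + 1 + i - j) (n + 1))) (reflect n i (n + 1)) x = Some y"
  proof cases
    case 1
    then show ?thesis
      using ij xn by (intro pmult3I[of _ _ "n + 1 + i - x" _ "n + 1 + x - j"]) (auto simp: reflect_eq_Some)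
  next
    case 2
    then show ?thesis
      using ij xn by (intro pmult3I[of _ _ x _ x]) (auto simp: reflect_eq_Some)
  next
    case 3
    then show ?thesis
      using ij xn by (intro pmult3I[of _ _ "n + 1 + i - x" _ "n + 1 + i - x"]) (auto simp: reflect_eq_Some)
  qed
next
  show "dom (pmult (pmult (reflect n i (n+1)) (reflect n (n + 1 + i - j) (n + 1))) (reflect n i (n + 1))) \<subseteq> dom (reflect n i j)"
  proof (rule subsetI, erule dom_pmult3[rotated])
    fix x u assume "reflect n i (n+1) x = Some u" "reflect n (n + 1 + i - j) (n + 1) u \<noteq> None"
    then show "x \<in> dom (reflect n i j)"
      using ij by (auto simp: reflect_def split: if_splits)
  qed
qed
text \<open>The first reflection brings the isolated point \<open>p + 1\<close> to \<open>1\<close>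
  and the gap \<open>p\<close> to \<open>2\<close>, where \<open>slide n 0\<close> acts; the last
  one restores the order of the points left of \<open>p\<close>.\<close>

lemma slide_conj:
  assumes p: "p + 2 \<le> n"
  shows "slide n p = pmult (pmult (reflect n 0 (p + 2)) (slide n 0)) (reflect n 0 p)"
proof (rule map_eq_leI)
  fix x y assume "slide n p x = Some y"
  then have xn: "1 \<le> x" "x \<le> n" 
   and "x < p \<and> y = x \<or> x = p + 1 \<and> y = n \<or> p + 2 < x \<and> x = y + 2"
    by (simp_all add: slide_eq_Some)
  then consider "x < p" "y = x" | "x = p + 1" "y = n" | "p + 2 < x" "x = y + 2" by blast
  then show "pmult (pmult (reflect n 0 (p + 2)) (slide n 0)) (reflect n 0 p) x = Some y"
  proof cases
    case 1
    then show ?thesis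
      using p xn by (intro pmult3I[of _ _ "p + 2 - x" _ "p - x"]) (auto simp: reflect_eq_Some slide_eq_Some)
  next
    case 2
    then show ?thesis
      using p xn by (intro pmult3I[of _ _ 1 _ n]) (auto simp: reflect_eq_Some slide_eq_Some)
  next
    case 3
    then show ?thesis
      using p xn by (intro pmult3I[of _ _ x _ y]) (auto simp: reflect_eq_Some slide_eq_Some)
  qed
next
  show "dom (pmult (pmult (reflect n 0 (p + 2)) (slide n 0)) (reflect n 0 p)) \<subseteq> dom (slide n p)"
  proof (rule subsetI, erule dom_pmult3[rotated])
    fix x u assume "reflect n 0 (p + 2) x = Some u" "slide n 0 u \<noteq> None"
    then show "x \<in> dom (slide n p)"
      using p by (auto simp: reflect_def slide_def split: if_splits)
  qed
qed

section \<open>Agreement with the identity on an initial segment\<close>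

text \<open>The condition is symmetric in arguments and values, hence invariant under inversion.\<close>

definition agree :: "(nat \<rightharpoonup> nat) \<Rightarrow> nat \<Rightarrow> bool" where
  "agree a m \<longleftrightarrow> (\<forall>x y. a x = Some y \<longrightarrow> x \<le> m \<or> y \<le> m \<longrightarrow> x = y)"

lemma agreeD: "agree a m \<Longrightarrow> a x = Some y \<Longrightarrow> x \<le> m \<or> y \<le> m \<Longrightarrow> x = y"
  unfolding agree_def by blast

lemma agree_pmult:
  assumes "agree a m" "agree g m"
  shows "agree (pmult a g) m"
  unfolding agree_def
proof (intro allI impI)
  fix x z assume "pmult a g x = Some z" and le: "x \<le> m \<or> z \<le> m"
  then obtain y where y: "a x = Some y" "g y = Some z" by (auto simp: pmult_eq_Some)
  show "x = z"
    using le agreeD[OF assms(1) y(1)] agreeD[OF assms(2) y(2)] by auto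
qed

lemma agree_pinv: "a \<in> IF n \<Longrightarrow> agree (pinv a) m \<longleftrightarrow> agree a m"
  unfolding agree_def by (auto simp: pinv_eq_Some)

lemma agree_reflect: "m \<le> i \<Longrightarrow> i \<le> j \<Longrightarrow> agree (reflect n i j) m"
  unfolding agree_def by (auto simp: reflect_eq_Some)

lemma agree_slide: "m \<le> p \<Longrightarrow> p + 2 \<le> n \<Longrightarrow> agree (slide n p) m"
  unfolding agree_def by (auto simp: slide_eq_Some)

lemma agree_not_ran: "agree a m \<Longrightarrow> m \<notin> dom a \<Longrightarrow> m \<notin> ran a"
  unfolding agree_def by (force simp: ran_def)

lemma agree_block:
  assumes a: "a \<in> IF n" and m: "agree a m" and b: "block a m q"
    and fixd: "\<And>x. m < x \<Longrightarrow> x < q \<Longrightarrow> a x = Some x"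
  shows "agree a q"
  unfolding agree_def
proof (intro allI impI)
  fix x y assume xy: "a x = Some y" and le: "x \<le> q \<or> y \<le> q"
  have q: "m + 1 < q" "m \<notin> dom a" "q \<notin> dom a" using b by (auto simp: block_def)
  consider "x \<le> m \<or> y \<le> m" | "m < x" "x < q" | "m < y" "y < q" | "x = q" | "y = q"
    using le by linarith
  then show "x = y"
  proof cases
    case 1
    then show ?thesis using agreeD[OF m xy] by blast
  next
    case 2
    then show ?thesis using fixd xy by simp
  next
    case 3
    then show ?thesis using fixd[of y] IF_inj[OF a xy] by simp
  next
    case 4
    then show ?thesis using q xy by auto
  next
    case 5
    \<comment> \<open>The value \<open>q\<close> is next to the fixed value \<open>q - 1\<close>, so
      its preimage is next to \<open>q - 1\<close>. As \<open>m\<close> and \<open>q\<close> are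
      gaps, this preimage lies in the block, where every point is fixed.\<close>
    have "a (q - 1) = Some (q - 1)" using fixd q by simp
    then have "x = q - 1 + 1 \<or> q - 1 = x + 1"
      using IF_adjacent[OF a _ xy, of "q - 1" "q - 1"] 5 q by simp
    moreover have "x \<noteq> m" "x \<noteq> q" using q xy by auto
    ultimately have "m < x" "x < q" using q by auto
    then show ?thesis using fixd[of x] xy by simp
  qed
qed

section \<open>The subsemigroup generated by one map per large domain\<close>

locale even_fence =
  fixes n :: nat
  assumes n_pos: "1 \<le> n" and n_even: "even n"
begin

lemma n2: "2 \<le> n"
  using n_pos n_even by presburger

text \<open>The index \<open>k\<close> is the point missing from the domain, and
  \<open>k = 0\<close> gives the identity. At \<open>2\<close> and \<open>n - 1\<close> the
  reflected part would be a single point, so nothing is lost by placing the slide and its inverse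
  there.\<close>

definition gen :: "nat \<Rightarrow> (nat \<rightharpoonup> nat)" where
  "gen k =
     (if k = 2 then slide n 0 else if k = n - 1 then pinv (slide n 0)
      else if even k then reflect n 0 k else reflect n k (n + 1))"

abbreviation S :: "(nat \<rightharpoonup> nat) set" where
  "S \<equiv> subsemigroup_gen pmult (gen ` {0..n})"

lemma gen_IF: "k \<le> n \<Longrightarrow> gen k \<in> IF n"
  using n2 n_even by (auto simp: gen_def intro!: slide_IF pinv_IF reflect_IF)

lemma gen_S: "k \<le> n \<Longrightarrow> gen k \<in> S"
  by (rule subsemigroup_gen.base) simp

lemma S_IF: "a \<in> S \<Longrightarrow> a \<in> IF n"
  by (induction rule: subsemigroup_gen.induct) (auto intro: gen_IF IF_closed)

text \<open>The reflections are involutions and the two slides are inverse to each other, so the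
  inverse of a generator is again a generator. This makes the closure under products alone an
  inverse semigroup.\<close>

lemma pinv_gen_S:
  assumes "k \<le> n"
  shows "pinv (gen k) \<in> S"
proof -
  have sl: "slide n 0 \<in> IF n" using n2 by (intro slide_IF) simp
  consider "k = 2" | "k \<noteq> 2" "k = n - 1" | "k \<noteq> 2" "k \<noteq> n - 1" by blast
  then show ?thesis
  proof cases
    case 1
    moreover have "n - 1 \<noteq> 2" using n_even n2 by presburger
    ultimately have "pinv (gen k) = gen (n - 1)" by (simp add: gen_def)
    then show ?thesis using gen_S[of "n - 1"] by simp
  next
    case 2
    then have "pinv (gen k) = gen 2" by (simp add: gen_def pinv_pinv[OF sl])
    then show ?thesis using gen_S[of 2] n2 by simp
  next
    case 3
    then have "pinv (gen k) = gen k"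
      using assms n_even by (auto simp: gen_def intro!: pinv_reflect)
    then show ?thesis using gen_S[OF assms] by simp
  qed
qed

lemma pinv_S: "a \<in> S \<Longrightarrow> pinv a \<in> S"
proof (induction rule: subsemigroup_gen.induct)
  case (base a)
  then show ?case using pinv_gen_S by auto
next
  case (mult a b)
  then show ?case
    using pinv_pmult[OF S_IF[OF mult.hyps(1)] S_IF[OF mult.hyps(2)]]
    by (simp add: subsemigroup_gen.mult)
qed

lemma dom_gen:
  assumes "k \<le> n"
  shows "dom (gen k) = {1..n} - {k}"
proof -
  have sl: "slide n 0 \<in> IF n" using n2 by (intro slide_IF) simp
  show ?thesis
    using n2 by (auto simp add: gen_def dom_slide dom_reflect dom_pinv[OF sl] ran_slide)
qed

text \<open>A generator times its inverse is the identity on its domain, which lacks a single point;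
  products of such idempotents intersect the domains.\<close>

lemma restrict_Some_S:
  assumes "finite F"
  shows "Some |` ({1..n} - F) \<in> S"
  using assms
proof (induction F)
  case empty
  have "Some |` dom (gen 0) \<in> S"
    using pmult_pinv_right[OF gen_IF[of 0]] subsemigroup_gen.mult[OF gen_S pinv_gen_S, of 0 0] by simp
  then show ?case by (simp add: dom_gen)
next
  case (insert k F)
  show ?case
  proof (cases "k \<le> n")
    case True
    have "Some |` ({1..n} - {k}) \<in> S"
      using pmult_pinv_right[OF gen_IF[OF True]]
        subsemigroup_gen.mult[OF gen_S[OF True] pinv_gen_S[OF True]] dom_gen[OF True] by simp
    from subsemigroup_gen.mult[OF this insert.IH]
    have "Some |` (({1..n} - {k}) \<inter> ({1..n} - F)) \<in> S" by (simp only: pmult_restrict_Some)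
    also have "({1..n} - {k}) \<inter> ({1..n} - F) = {1..n} - insert k F" by auto
    finally show ?thesis .
  next
    case False
    then have "{1..n} - insert k F = {1..n} - F" by auto
    then show ?thesis using insert.IH by simp
  qed
qed

text \<open>The only even \<open>j\<close> whose reflection is not a generator is \<open>2\<close>,
  where just the point \<open>1\<close> is reflected and the map is a partial identity.\<close>

lemma reflect_left_S:
  assumes "even j" "j \<le> n"
  shows "reflect n 0 j \<in> S"
proof (cases "j = 2")
  case True
  have "reflect n 0 j = Some |` ({1..n} - {2})"
    unfolding True by (rule map_eqI) (auto simp: reflect_eq_Some restrict_Some_eq_Some)
  then show ?thesis using restrict_Some_S[of "{2}"] by simp
next
  case False
  moreover have "j \<noteq> n - 1" using assms n_even n2 by presburger
  ultimately have "gen j = reflect n 0 j" using assms by (simp add: gen_def)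
  then show ?thesis using gen_S[OF assms(2)] by simp
qed

lemma reflect_right_S:
  assumes "odd i" "i \<le> n + 1"
  shows "reflect n i (n + 1) \<in> S"
proof -
  have "i \<noteq> 2" "i \<noteq> n" using assms(1) n_even by auto
  then consider "i = n + 1" | "i = n - 1" | "i \<noteq> 2" "i < n - 1"
    using assms(2) by linarith
  then show ?thesis
  proof cases
    case 1
    have "reflect n i (n + 1) = Some |` ({1..n} - {})"
      unfolding 1 by (rule map_eqI) (auto simp: reflect_eq_Some restrict_Some_eq_Some)
    then show ?thesis using restrict_Some_S[of "{}"] by simp
  next
    case 2
    have "reflect n i (n + 1) = Some |` ({1..n} - {n - 1})"
      unfolding 2 using n2 by (intro map_eqI) (auto simp: reflect_eq_Some restrict_Some_eq_Some)
    then show ?thesis using restrict_Some_S[of "{n - 1}"] by simp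
  next
    case 3
    then have "gen i = reflect n i (n + 1)" using assms by (simp add: gen_def)
    then show ?thesis using gen_S[of i] 3 by simp
  qed
qed

text \<open>Two even gaps are handled by conjugating reflections at the left end of the fence, two
  odd gaps by conjugating reflections at the right end; \<open>n + 1\<close> is odd.\<close>

lemma reflect_S:
  assumes ij: "even (i + j)" "i \<le> j" "j \<le> n + 1"
  shows "reflect n i j \<in> S"
proof (cases "even j")
  case True
  then have e: "even (j - i)" "j \<le> n" using ij n_even by (auto simp: le_Suc_eq)
  show ?thesis
    unfolding reflect_conj_left[OF ij(2) e(2)]
    using True e by (auto intro!: subsemigroup_gen.mult reflect_left_S)
next
  case False
  then have o: "odd i" "odd (n + 1 + i - j)" "n + 1 + i - j \<le> n + 1" "i \<le> n + 1"
    using ij n_even by auto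
  show ?thesis
    unfolding reflect_conj_right[OF ij(2,3) o(1)]
    by (intro subsemigroup_gen.mult reflect_right_S o)
qed

lemma slide_S:
  assumes "even p" "p + 2 \<le> n"
  shows "slide n p \<in> S"
proof -
  have "slide n 0 \<in> S" using gen_S[of 2] n2 by (simp add: gen_def)
  then show ?thesis
    unfolding slide_conj[OF assms(2)]
    using assms by (auto intro!: subsemigroup_gen.mult reflect_left_S)
qed

section \<open>Moving the image of a block into place\<close>

text \<open>Since \<open>g\<close> is defined on all of \<open>ran a\<close>, multiplying by
  \<open>g\<close> can be undone by \<open>pinv g\<close>, so it suffices to treat
  \<open>pmult a g\<close>. The last premise keeps only those properties of this product that later
  moves rely on.\<close>

lemma move_S:
  assumes a: "a \<in> IF n" and g: "g \<in> S" and ran: "ran a \<subseteq> dom g"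
    and ag: "agree a m" "agree g m"
    and b: "\<And>b. b \<in> IF n \<Longrightarrow> dom b = dom a \<Longrightarrow> agree b m \<Longrightarrow>
      (\<And>x y. a x = Some y \<Longrightarrow> b x = g y) \<Longrightarrow> b \<in> S"
  shows "a \<in> S"
proof -
  have "pmult a g \<in> S"
  proof (rule b)
    show "pmult a g \<in> IF n" using IF_closed[OF a S_IF[OF g]] .
    show "dom (pmult a g) = dom a"
      using ran by (auto simp: dom_def pmult_eq_Some ran_def subset_iff)
    show "agree (pmult a g) m" using agree_pmult[OF ag] .
    show "pmult a g x = g y" if "a x = Some y" for x y
      using that by (simp add: pmult_def map_comp_def)
  qed
  then have "pmult (pmult a g) (pinv g) \<in> S" using pinv_S[OF g] by (rule subsemigroup_gen.mult)
  then show ?thesis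
    by (simp add: pmult_assoc pmult_pinv_right[OF S_IF[OF g]] pmult_restrict_right[OF ran])
qed

text \<open>The remaining task once the block between \<open>m\<close> and \<open>q\<close> is
  fixed, to be supplied by the induction hypothesis. It depends on the domain only, because moves
  act on values and leave the domain unchanged.\<close>

definition settled :: "nat set \<Rightarrow> nat \<Rightarrow> nat \<Rightarrow> bool" where
  "settled D m q \<longleftrightarrow>
     (\<forall>b\<in>IF n. dom b = D \<longrightarrow> agree b m \<longrightarrow> (\<forall>x. m < x \<longrightarrow> x < q \<longrightarrow> b x = Some x) \<longrightarrow> b \<in> S)"

lemma settledD:
  "settled (dom a) m q \<Longrightarrow> b \<in> IF n \<Longrightarrow> dom b = dom a \<Longrightarrow> agree b m \<Longrightarrow>
     (\<And>x. m < x \<Longrightarrow> x < q \<Longrightarrow> b x = Some x) \<Longrightarrow> b \<in> S"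
  unfolding settled_def by blast

lemma reflect_move_S:
  assumes a: "a \<in> IF n" "agree a m" "i \<notin> ran a" "j \<notin> ran a"
    and ij: "even (i + j)" "i \<le> j" "j \<le> n + 1" "m \<le> i"
    and b: "\<And>b. b \<in> IF n \<Longrightarrow> dom b = dom a \<Longrightarrow> agree b m \<Longrightarrow>
      (\<And>x y. a x = Some y \<Longrightarrow> b x = reflect n i j y) \<Longrightarrow> b \<in> S"
  shows "a \<in> S"
proof (rule move_S[OF a(1) reflect_S[OF ij(1-3)] _ a(2)])
  show "ran a \<subseteq> dom (reflect n i j)"
    using a(3,4) IF_ran[OF a(1)] by (auto simp: dom_reflect)
  show "agree (reflect n i j) m" using agree_reflect[OF ij(4,2)] .
qed (rule b)

lemma block_dom: "block a m q \<Longrightarrow> dom b = dom a \<Longrightarrow> block b m q"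
  unfolding block_def by simp

lemma block_eq_Some:
  assumes "block a m q" "m < x" "x < q"
  obtains y where "a x = Some y"
proof -
  have "x \<in> dom a" using assms unfolding block_def by auto
  then show ?thesis using that by auto
qed

text \<open>A block mapped onto itself is either fixed pointwise or reversed. A reversal with
  \<open>even (q - m)\<close> is undone by one reflection; otherwise it would change
  parities.\<close>

lemma front_S:
  assumes a: "a \<in> IF n" "agree a m" and bl: "block a m q" and st: "settled (dom a) m q"
    and img: "\<And>x y. m < x \<Longrightarrow> x < q \<Longrightarrow> a x = Some y \<Longrightarrow> m < y \<and> y < q"
  shows "a \<in> S"
proof -
  have q: "m + 1 < q" "m \<notin> dom a" using bl by (auto simp: block_def)
  obtain p where p: "p + (q - m) \<notin> ran a" "p + (q - m) \<le> n + 1"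
    and or: "(\<forall>x. m < x \<longrightarrow> x < q \<longrightarrow> a x = Some (p + (x - m))) \<or>
             (\<forall>x. m < x \<longrightarrow> x < q \<longrightarrow> a x = Some (p + (q - x)))"
    using block_image[OF a(1) bl] by metis
  have lt: "m < m + 1" "m + 1 < q" "m < q - 1" "q - 1 < q" using q(1) by auto
  from or show ?thesis
  proof
    assume up: "\<forall>x. m < x \<longrightarrow> x < q \<longrightarrow> a x = Some (p + (x - m))"
    have "a (m + 1) = Some (p + 1)" "a (q - 1) = Some (p + (q - 1 - m))"
      using up q(1) by auto
    from img[OF lt(1,2) this(1)] img[OF lt(3,4) this(2)] have "p = m" by linarith
    then show ?thesis
      using up by (intro settledD[OF st a(1) refl a(2)]) simp
  next
    assume down: "\<forall>x. m < x \<longrightarrow> x < q \<longrightarrow> a x = Some (p + (q - x))"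
    have "a (m + 1) = Some (p + (q - (m + 1)))" "a (q - 1) = Some (p + 1)"
      using down q(1) by auto
    from img[OF lt(1,2) this(1)] img[OF lt(3,4) this(2)] have pm: "p = m" by linarith
    show ?thesis
    proof (cases "even (q - m)")
      case True
      then have ev: "even (m + q)" using q by (simp add: even_diff_nat)
      have mr: "m \<notin> ran a" using agree_not_ran[OF a(2) q(2)] .
      have qr: "q \<notin> ran a" "q \<le> n + 1" using p pm q by auto
      show ?thesis
      proof (rule reflect_move_S[OF a mr qr(1) ev _ qr(2) le_refl])
        show "m \<le> q" using q by simp
        fix b assume b: "b \<in> IF n" "dom b = dom a" "agree b m"
          and bx: "\<And>x y. a x = Some y \<Longrightarrow> b x = reflect n m q y"
        show "b \<in> S"
        proof (rule settledD[OF st b])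
          fix x assume x: "m < x" "x < q"
          have "a x = Some (m + (q - x))" using down x pm by simp
          then have "b x = reflect n m q (m + (q - x))" by (rule bx)
          also have "\<dots> = Some x"
            using x q qr by (subst reflect_eq_Some) auto
          finally show "b x = Some x" .
        qed
      qed
    next
      case False
      \<comment> \<open>The block has an even number of points, at least two, so its end points have
        different parities and cannot be exchanged.\<close>
      then have "m + 3 \<le> q" using q by presburger
      moreover have "a (m + 1) = Some (q - 1)" using down[rule_format, of "m + 1"] pm q by simp
      ultimately have "even (m + 1) \<longleftrightarrow> even (q - 1)"
        using block_parity[OF a(1) bl, of "m + 1"] by simp
      then show ?thesis using False q by presburger
    qed
  qed
qed

text \<open>The gap right of the image has the parity of \<open>m\<close>, so a reflection between
  these two gaps brings the image directly behind \<open>m\<close>. Its orientation is left to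
  \<open>front_S\<close>.\<close>

lemma right_even_S:
  assumes a: "a \<in> IF n" "agree a m" and bl: "block a m q" and st: "settled (dom a) m q"
    and img: "\<And>x y. m < x \<Longrightarrow> x < q \<Longrightarrow> a x = Some y \<Longrightarrow> p < y \<and> y < p + (q - m)"
    and p: "m \<le> p" "p + (q - m) \<notin> ran a" "p + (q - m) \<le> n + 1" "even (m + (p + (q - m)))"
  shows "a \<in> S"
proof -
  have q: "m + 1 < q" "m \<notin> dom a" using bl by (auto simp: block_def)
  have mr: "m \<notin> ran a" using agree_not_ran[OF a(2) q(2)] .
  show ?thesis
  proof (rule reflect_move_S[OF a mr p(2,4) _ p(3) le_refl])
    show "m \<le> p + (q - m)" using p by simp
    fix b assume b: "b \<in> IF n" "dom b = dom a" "agree b m"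
      and bx: "\<And>x y. a x = Some y \<Longrightarrow> b x = reflect n m (p + (q - m)) y"
    have "settled (dom b) m q" using st b(2) by simp
    then show "b \<in> S"
    proof (rule front_S[OF b(1,3) block_dom[OF bl b(2)]])
      fix x z assume x: "m < x" "x < q" "b x = Some z"
      then obtain y where y: "a x = Some y" using block_eq_Some[OF bl] by blast
      have "reflect n m (p + (q - m)) y = Some z" using bx[OF y] x by simp
      then show "m < z \<and> z < q"
        using img[OF x(1,2) y] p(1) q by (subst (asm) reflect_eq_Some) auto
    qed
  qed
qed

text \<open>
  Only a block of length one can be mapped to a place of the wrong parity; it is first taken to the
  far right of the fence by a reflection or a slide.
\<close>

lemma odd_block_S:
  assumes a: "a \<in> IF n" "agree a m" and bl: "block a m q" and st: "settled (dom a) m q"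
    and ev: "even (q - m)"
  shows "a \<in> S"
proof -
  have q: "m + 1 < q" "m \<notin> dom a" using bl by (auto simp: block_def)
  obtain p where p: "p \<notin> ran a" "p + (q - m) \<notin> ran a" "p + (q - m) \<le> n + 1"
    and or: "(\<forall>x. m < x \<longrightarrow> x < q \<longrightarrow> a x = Some (p + (x - m))) \<or>
             (\<forall>x. m < x \<longrightarrow> x < q \<longrightarrow> a x = Some (p + (q - x)))"
    using block_image[OF a(1) bl] by metis
  have img: "p < y \<and> y < p + (q - m)" if "m < x" "x < q" "a x = Some y" for x y
    using or that by auto
  obtain x where x: "m < x" "x < q" "a x = Some (p + 1)"
  proof -
    from or have "a (m + 1) = Some (p + 1) \<or> a (q - 1) = Some (p + 1)" using q by auto
    moreover have "m < m + 1" "m + 1 < q" "m < q - 1" "q - 1 < q" using q(1) by auto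
    ultimately show ?thesis using that by blast
  qed
  have mp: "m \<le> p" using agreeD[OF a(2) x(3)] x(1) by linarith
  show ?thesis
  proof (cases "even (m + p)")
    case True
    then show ?thesis
      using right_even_S[OF a bl st img mp p(2,3)] ev by simp
  next
    case False
    have q2: "q = m + 2"
    proof (rule ccontr)
      assume "q \<noteq> m + 2"
      then have q3: "m + 3 \<le> q" using q by simp
      have "a (m + 1) = Some (p + 1) \<or> a (m + 1) = Some (p + (q - m) - 1)"
        using or q by auto
      then have "even (m + 1) \<longleftrightarrow> even (p + 1)"
        using block_parity[OF a(1) bl q3, of "m + 1"] q ev by auto
      then show False using False by simp
    qed
    have a1: "a (m + 1) = Some (p + 1)" using x q2 by (cases "x = m + 1") auto
    have mp': "m + 1 \<le> p" using mp False by (cases "m = p") auto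
    have p2: "p + 2 \<notin> ran a" "p + 2 \<le> n + 1" using p q2 by auto
    have out: "n + 1 \<notin> ran b" if "b \<in> IF n" for b
      using IF_ran[OF that] by auto
    show ?thesis
    proof (cases "even m")
      case True
      then have podd: "odd p" using False by simp
      have m2: "m + 2 \<le> n" using True podd mp' p2 by presburger
      have sl: "slide n m \<in> IF n" using slide_IF[OF m2] .
      \<comment> \<open>With \<open>p\<close> odd, the reflection between \<open>p\<close> and
        \<open>n + 1\<close> takes the point \<open>p + 1\<close> to \<open>n\<close>. The inverse
        of the slide at the even gap \<open>m\<close> then takes \<open>n\<close> to
        \<open>m + 1\<close>.\<close>
      show ?thesis
      proof (rule reflect_move_S[OF a p(1) out[OF a(1)] _ _ le_refl mp])
        show "even (p + (n + 1))" "p \<le> n + 1" using podd n_even p2 by auto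
        fix b assume b: "b \<in> IF n" "dom b = dom a" "agree b m"
          and bx: "\<And>x y. a x = Some y \<Longrightarrow> b x = reflect n p (n + 1) y"
        have b1: "b (m + 1) = Some n"
          using bx[OF a1] p2 by (simp add: reflect_eq_Some)
        have mb: "m \<notin> ran b" using agree_not_ran[OF b(3)] b(2) q by simp
        \<comment> \<open>The reflection sends \<open>p + 2\<close> to \<open>n - 1\<close>, and
          \<open>p + 2\<close> is a gap of the range; hence the inverse slide is defined on all of
          \<open>ran b\<close>.\<close>
        have nb: "n - 1 \<notin> ran b"
        proof
          assume "n - 1 \<in> ran b"
          then obtain z where z: "b z = Some (n - 1)" by (auto simp: ran_def)
          then obtain y where y: "a z = Some y" using b(2) by (metis domD domI)
          then have "reflect n p (n + 1) y = Some (n - 1)" using bx z by simp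
          then have "y = p + 2" using p2(2) by (auto simp: reflect_eq_Some)
          then show False using p2(1) y by (auto simp: ran_def)
        qed
        show "b \<in> S"
        proof (rule move_S[OF b(1) pinv_S[OF slide_S[OF True m2]] _ b(3)])
          show "ran b \<subseteq> dom (pinv (slide n m))"
            using mb nb IF_ran[OF b(1)] by (auto simp: dom_pinv[OF sl] ran_slide[OF m2])
          show "agree (pinv (slide n m)) m"
            using agree_slide[OF le_refl m2] by (simp add: agree_pinv[OF sl])
          fix c assume c: "c \<in> IF n" "dom c = dom b" "agree c m"
            and cx: "\<And>x y. b x = Some y \<Longrightarrow> c x = pinv (slide n m) y"
          have c1: "c (m + 1) = Some (m + 1)"
            unfolding cx[OF b1] pinv_eq_Some[OF sl] using m2 by (simp add: slide_eq_Some)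
          have "dom c = dom a" using b(2) c(2) by simp
          then show "c \<in> S"
          proof (rule settledD[OF st c(1) _ c(3)])
            fix x assume "m < x" "x < q"
            then have "x = m + 1" using q2 by simp
            then show "c x = Some x" using c1 by simp
          qed
        qed
      qed
    next
      case modd: False
      then have peven: "even p" using False by simp
      then have p2n: "p + 2 \<le> n" using p2(2) n_even by presburger
      \<comment> \<open>With \<open>p\<close> even, the slide at \<open>p\<close> takes
        \<open>p + 1\<close> to \<open>n\<close>. Its right gap is then \<open>n + 1\<close>, which
        has the parity of \<open>m\<close>, so \<open>right_even_S\<close> applies with
        \<open>n - 1\<close> in place of \<open>p\<close>.\<close>
      show ?thesis
      proof (rule move_S[OF a(1) slide_S[OF peven p2n] _ a(2) agree_slide[OF mp p2n]])
        show "ran a \<subseteq> dom (slide n p)"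
          using p(1) p2(1) IF_ran[OF a(1)] by (auto simp: dom_slide)
        fix b assume b: "b \<in> IF n" "dom b = dom a" "agree b m"
          and bx: "\<And>x y. a x = Some y \<Longrightarrow> b x = slide n p y"
        have b1: "b (m + 1) = Some n"
          using bx[OF a1] p2n by (simp add: slide_eq_Some)
        have st': "settled (dom b) m q" using st b(2) by simp
        show "b \<in> S"
        proof (rule right_even_S[OF b(1,3) block_dom[OF bl b(2)] st'])
          show "n - 1 < y \<and> y < n - 1 + (q - m)" if "m < x" "x < q" "b x = Some y" for x y
          proof -
            have "x = m + 1" using that q2 by simp
            then show ?thesis using b1 that(3) n2 q2 by simp
          qed
          have e: "n - 1 + (q - m) = n + 1" using n2 q2 by simp
          show "m \<le> n - 1" using mp' p2n by simp
          show "n - 1 + (q - m) \<notin> ran b" unfolding e using out[OF b(1)] .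
          show "n - 1 + (q - m) \<le> n + 1" unfolding e by simp
          show "even (m + (n - 1 + (q - m)))" unfolding e using modd n_even by simp
        qed
      qed
    qed
  qed
qed

text \<open>
  A block of even length lies between gaps of different parity. If its image does too, in the same
  order, the intermediate gap \<open>r\<close> is used to turn it around before it is reflected to the front.
\<close>

lemma even_block_S:
  assumes a: "a \<in> IF n" "agree a m" and bl: "block a m q" and st: "settled (dom a) m q"
    and od: "odd (q - m)"
    and r: "m < r" "r \<notin> ran a" "odd (r - m)" "\<And>y. m < y \<Longrightarrow> y < r \<Longrightarrow> y \<in> ran a"
  shows "a \<in> S"
proof -
  have q: "m + 1 < q" "m \<notin> dom a" using bl by (auto simp: block_def)
  obtain p where p: "p \<notin> ran a" "p + (q - m) \<notin> ran a" "p + (q - m) \<le> n + 1"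
    and or: "(\<forall>x. m < x \<longrightarrow> x < q \<longrightarrow> a x = Some (p + (x - m))) \<or>
             (\<forall>x. m < x \<longrightarrow> x < q \<longrightarrow> a x = Some (p + (q - x)))"
    using block_image[OF a(1) bl] by metis
  have img: "p < y \<and> y < p + (q - m)" if "m < x" "x < q" "a x = Some y" for x y
    using or that by auto
  obtain x where x: "m < x" "x < q" "a x = Some (p + 1)"
  proof -
    from or have "a (m + 1) = Some (p + 1) \<or> a (q - 1) = Some (p + 1)" using q by auto
    moreover have "m < m + 1" "m + 1 < q" "m < q - 1" "q - 1 < q" using q(1) by auto
    ultimately show ?thesis using that by blast
  qed
  have mp: "m \<le> p" using agreeD[OF a(2) x(3)] x(1) by linarith
  consider "odd (m + p)" | "p = m" | "even (m + p)" "m < p" using mp by linarith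
  then show ?thesis
  proof cases
    case 1
    then show ?thesis
      using right_even_S[OF a bl st img mp p(2,3)] od by simp
  next
    case 2
    have "m < y \<and> y < q" if "m < x" "x < q" "a x = Some y" for x y
      using img[OF that] 2 q(1) by simp
    then show ?thesis by (rule front_S[OF a bl st])
  next
    case 3
    \<comment> \<open>The gap \<open>r\<close> is the first one of the range after \<open>m\<close>,
      and \<open>p\<close> is such a gap; their parities differ.\<close>
    have "r \<le> p" using r(4)[OF 3(2)] p(1) by (meson not_le)
    moreover have "r \<noteq> p" using 3 r(1,3) by presburger
    ultimately have rp: "r < p" by simp
    \<comment> \<open>The gaps \<open>r\<close> and \<open>p + (q - m)\<close> have equal parity, so
      the reflection between them is available. It puts the image directly behind \<open>r\<close>,
      and the new right gap \<open>r + (q - m)\<close> has the parity of \<open>m\<close>.\<close>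
    show ?thesis
    proof (rule reflect_move_S[OF a r(2) p(2) _ _ p(3)])
      show "even (r + (p + (q - m)))" using 3 r(1,3) od by presburger
      show "r \<le> p + (q - m)" "m \<le> r" using rp r by auto
      fix b assume b: "b \<in> IF n" "dom b = dom a" "agree b m"
        and bx: "\<And>x y. a x = Some y \<Longrightarrow> b x = reflect n r (p + (q - m)) y"
      have rl: "r \<le> p + (q - m)" using rp by simp
      have st': "settled (dom b) m q" using st b(2) by simp
      show "b \<in> S"
      proof (rule right_even_S[OF b(1,3) block_dom[OF bl b(2)] st'])
        fix x z assume x: "m < x" "x < q" "b x = Some z"
        then obtain y where y: "a x = Some y" using block_eq_Some[OF bl] by blast
        have "reflect n r (p + (q - m)) y = Some z" using bx[OF y] x by simp
        then show "r < z \<and> z < r + (q - m)"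
          using img[OF x(1,2) y] rp unfolding reflect_eq_Some[OF rl] by auto
      next
        \<comment> \<open>This value is the reflected position of \<open>p\<close>, which is a gap
          of \<open>ran a\<close>.\<close>
        show "r + (q - m) \<notin> ran b"
        proof
          assume "r + (q - m) \<in> ran b"
          then obtain z where z: "b z = Some (r + (q - m))" by (auto simp: ran_def)
          then obtain y where y: "a z = Some y" using b(2) by (metis domD domI)
          then have "reflect n r (p + (q - m)) y = Some (r + (q - m))" using bx z by simp
          then have "y = p" using rp q unfolding reflect_eq_Some[OF rl] by auto
          then show False using p(1) y by (auto simp: ran_def)
        qed
        show "m \<le> r" "r + (q - m) \<le> n + 1" using r(1) rp p(3) by auto
        show "even (m + (r + (q - m)))" using r(1,3) od by presburger
      qed
    qed
  qed
qed

section \<open>Induction from left to right over the gaps\<close>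

lemma next_gap:
  assumes "A \<subseteq> {1..n}" "m \<le> n"
  obtains q where "m < q" "q \<le> n + 1" "q \<notin> A" "\<And>x. m < x \<Longrightarrow> x < q \<Longrightarrow> x \<in> A"
proof -
  define q where "q = (LEAST q. m < q \<and> q \<notin> A)"
  have ex: "m < n + 1 \<and> n + 1 \<notin> A" using assms by auto
  show ?thesis
  proof (rule that)
    show "m < q" "q \<notin> A"
      using LeastI[of "\<lambda>q. m < q \<and> q \<notin> A", OF ex] by (simp_all add: q_def)
    show "q \<le> n + 1"
      using Least_le[of "\<lambda>q. m < q \<and> q \<notin> A", OF ex] by (simp add: q_def)
    show "x \<in> A" if "m < x" "x < q" for x
      using not_less_Least[of x "\<lambda>q. m < q \<and> q \<notin> A"] that by (auto simp: q_def)
  qed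
qed

text \<open>Induction on the distance from the gap \<open>m\<close> to \<open>n + 1\<close>. Each
  step settles the first block of the domain or, after inversion, the first block of the range, or
  passes over a gap common to both.\<close>

lemma agree_S:
  assumes "a \<in> IF n" "agree a m" "m \<notin> dom a" "m \<le> n + 1"
  shows "a \<in> S"
  using assms
proof (induction "n + 1 - m" arbitrary: a m rule: less_induct)
  case less
  note IH = less.hyps
  show ?case
  proof (cases "m = n + 1")
    case True
    have D: "dom a \<subseteq> {1..n}" using IF_dom[OF less.prems(1)] .
    have "a x = Some y \<longleftrightarrow> x \<in> dom a \<and> y = x" for x y
    proof
      assume xy: "a x = Some y"
      then have "x = y"
        using agreeD[OF less.prems(2) xy] IF_range[OF less.prems(1) xy] True by simp
      then show "x \<in> dom a \<and> y = x" using xy by auto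
    next
      assume xy: "x \<in> dom a \<and> y = x"
      then obtain z where z: "a x = Some z" by auto
      then have "x = z"
        using agreeD[OF less.prems(2) z] IF_range[OF less.prems(1) z] True by simp
      then show "a x = Some y" using xy z by simp
    qed
    then have "a = Some |` dom a"
      by (intro map_eqI) (simp add: restrict_Some_eq_Some)
    moreover have "Some |` dom a \<in> S"
      using restrict_Some_S[of "{1..n} - dom a"] D by (simp add: double_diff)
    ultimately show ?thesis by metis
  next
    case False
    then have mn: "m \<le> n" using less.prems(4) by simp
    \<comment> \<open>Once the block is fixed, the map agrees with the identity up to the later gap
      \<open>q\<close>, where the induction hypothesis applies.\<close>
    have settle: "settled (dom c) m q" if "block c m q" "q \<le> n + 1" for c q
      unfolding settled_def
    proof (intro ballI impI)
      fix b assume b: "b \<in> IF n" "dom b = dom c" "agree b m"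
        and fixd: "\<forall>x. m < x \<longrightarrow> x < q \<longrightarrow> b x = Some x"
      have bl: "block b m q" using block_dom[OF that(1) b(2)] .
      then have q: "m + 1 < q" "q \<notin> dom b" by (auto simp: block_def)
      show "b \<in> S"
      proof (rule IH[OF _ b(1) _ q(2) that(2)])
        show "n + 1 - q < n + 1 - m" using q mn by simp
        show "agree b q" using agree_block[OF b(1,3) bl] fixd by blast
      qed
    qed
    \<comment> \<open>Stated for arbitrary \<open>c\<close> because it is applied both to
      \<open>a\<close> and to \<open>pinv a\<close>; inversion exchanges the roles of
      \<open>q\<close> and \<open>r\<close>.\<close>
    have step: "c \<in> S"
      if c: "c \<in> IF n" "agree c m" "m \<notin> dom c"
        and q: "m < q" "q \<le> n + 1" "q \<notin> dom c" "\<And>x. m < x \<Longrightarrow> x < q \<Longrightarrow> x \<in> dom c"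
        and r: "m < r" "r \<notin> ran c" "\<And>x. m < x \<Longrightarrow> x < r \<Longrightarrow> x \<in> ran c"
        and par: "even (q - m) \<or> odd (q - m) \<and> odd (r - m) \<and> q \<noteq> m + 1" for c q r
    proof -
      \<comment> \<open>The parity condition rules out \<open>q = m + 1\<close>, so the block is not
        empty.\<close>
      have "m + 1 < q" using q(1) par by (cases "q = m + 1") auto
      moreover have "{m<..<q} \<subseteq> dom c" using q(4) by (meson greaterThanLessThan_iff subsetI)
      ultimately have bl: "block c m q" using q(3) c(3) unfolding block_def by blast
      show ?thesis
      proof (cases "even (q - m)")
        case True
        then show ?thesis using odd_block_S[OF c(1,2) bl settle[OF bl q(2)]] by simp
      next
        case False
        then show ?thesis
          using even_block_S[OF c(1,2) bl settle[OF bl q(2)] _ r(1,2) _ r(3)] par by blast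
      qed
    qed
    note a = less.prems(1)
    obtain q where q: "m < q" "q \<le> n + 1" "q \<notin> dom a" "\<And>x. m < x \<Longrightarrow> x < q \<Longrightarrow> x \<in> dom a"
      using next_gap[OF IF_dom[OF a] mn] by blast
    obtain r where r: "m < r" "r \<le> n + 1" "r \<notin> ran a" "\<And>x. m < x \<Longrightarrow> x < r \<Longrightarrow> x \<in> ran a"
      using next_gap[OF IF_ran[OF a] mn] by blast
    have inv_step: "a \<in> S" if "even (r - m) \<or> odd (r - m) \<and> odd (q - m) \<and> r \<noteq> m + 1"
    proof -
      have "pinv a \<in> S"
      proof (rule step[where q = r and r = q])
        show "pinv a \<in> IF n" "agree (pinv a) m" "m \<notin> dom (pinv a)"
          using less.prems(2) agree_not_ran[OF less.prems(2,3)]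
          by (simp_all add: pinv_IF[OF a] agree_pinv[OF a] dom_pinv[OF a])
      qed (use that q r in \<open>simp_all add: dom_pinv[OF a] ran_pinv[OF a]\<close>)
      then show ?thesis using pinv_S[of "pinv a"] by (simp add: pinv_pinv[OF a])
    qed
    \<comment> \<open>If both distances are odd and one of the two first blocks is nonempty, the
      other first gap serves as the intermediate gap. What remains is that both first blocks are
      empty.\<close>
    consider "even (q - m) \<or> odd (q - m) \<and> odd (r - m) \<and> q \<noteq> m + 1"
      | "even (r - m) \<or> odd (r - m) \<and> odd (q - m) \<and> r \<noteq> m + 1"
      | "q = m + 1" "r = m + 1" by blast
    then show ?thesis
    proof cases
      case 1
      then show ?thesis using step[OF a less.prems(2,3) q r(1,3,4)] by blast
    next
      case 2
      then show ?thesis by (rule inv_step)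
    next
      case 3
      have "agree a (m + 1)"
        unfolding agree_def
      proof (intro allI impI)
        fix x y assume xy: "a x = Some y" "x \<le> m + 1 \<or> y \<le> m + 1"
        have "x \<noteq> m + 1" "y \<noteq> m + 1" using 3 q(3) r(3) xy(1) by (auto simp: ran_def)
        then show "x = y" using agreeD[OF less.prems(2) xy(1)] xy(2) by linarith
      qed
      then show ?thesis using IH[OF _ a, of "m + 1"] 3 q(2,3) mn by simp
    qed
  qed
qed

lemma S_eq: "S = IF n"
proof
  show "S \<subseteq> IF n" using S_IF by blast
  show "IF n \<subseteq> S"
  proof
    fix a assume a: "a \<in> IF n"
    have "agree a 0" unfolding agree_def using IF_range[OF a] by fastforce
    moreover have "0 \<notin> dom a" using IF_range[OF a] by fastforce
    ultimately show "a \<in> S" using agree_S[OF a] by simp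
  qed
qed

section \<open>Lower bound for generating sets\<close>

lemma pmult_restrict_left: "dom b \<subseteq> D \<Longrightarrow> pmult (Some |` D) b = b"
  by (intro map_eqI) (auto simp: pmult_eq_Some restrict_Some_eq_Some)

text \<open>The whole fence is one block, so the map is the identity or the reversal. The reversal
  sends \<open>1\<close> to \<open>n\<close>, which is even, so it violates parity.\<close>

lemma full_dom_id:
  assumes a: "a \<in> IF n" and d: "dom a = {1..n}"
  shows "a = Some |` {1..n}"
proof -
  have bl: "block a 0 (n + 1)" using n2 d by (auto simp: block_def)
  obtain p where p: "p + (n + 1) \<le> n + 1"
    and or: "(\<forall>x. 0 < x \<longrightarrow> x < n + 1 \<longrightarrow> a x = Some (p + x)) \<or>
             (\<forall>x. 0 < x \<longrightarrow> x < n + 1 \<longrightarrow> a x = Some (p + (n + 1 - x)))"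
    using block_image[OF a bl] by (metis diff_zero)
  have "a 1 \<noteq> Some n"
    using block_parity[OF a bl, of 1 n] n2 n_even by auto
  moreover have "p = 0" using p by simp
  ultimately have "a x = Some x" if "x \<in> {1..n}" for x
    using or n2 that by (elim disjE) auto
  moreover have "a x = None" if "x \<notin> {1..n}" for x
    using that d by blast
  ultimately show ?thesis by (simp add: fun_eq_iff restrict_map_def)
qed

lemma generator_dom:
  assumes A: "A \<subseteq> IF n" and x: "x \<in> subsemigroup_gen pmult A" and k: "dom x = {1..n} - {k}"
  shows "\<exists>a\<in>A. dom a = {1..n} - {k}"
  using x k
proof (induction rule: subsemigroup_gen.induct)
  case (base a)
  then show ?case by blast
next
  case (mult a b)
  have sub: "c \<in> IF n" if "c \<in> subsemigroup_gen pmult A" for c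
    using that by induction (use A in \<open>auto intro: IF_closed\<close>)
  have a: "a \<in> IF n" and b: "b \<in> IF n" using mult.hyps sub by auto
  have "{1..n} - {k} \<subseteq> dom a"
    unfolding mult.prems[symmetric] by (auto simp: dom_def pmult_eq_Some)
  moreover have "dom a \<subseteq> {1..n}" using IF_dom[OF a] .
  ultimately consider "dom a = {1..n} - {k}" | "dom a = {1..n}" by blast
  then show ?case
  proof cases
    case 1
    then show ?thesis by (rule mult.IH(1))
  next
    case 2
    have "pmult a b = b"
      unfolding full_dom_id[OF a 2] by (rule pmult_restrict_left[OF IF_dom[OF b]])
    then show ?thesis using mult.IH(2) mult.prems by simp
  qed
qed

lemma card_generating_set:
  assumes A: "A \<subseteq> IF n" "subsemigroup_gen pmult A = IF n"
  shows "n + 1 \<le> card A"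
proof -
  have fin: "finite A" using A(1) finite_IF by (rule finite_subset)
  have sub: "(\<lambda>k. {1..n} - {k}) ` {0..n} \<subseteq> dom ` A"
  proof (rule image_subsetI)
    fix k assume "k \<in> {0..n}"
    \<comment> \<open>The map \<open>gen k\<close> serves only as a witness that this domain occurs
      in \<open>IF n\<close>.\<close>
    then have "gen k \<in> subsemigroup_gen pmult A" "dom (gen k) = {1..n} - {k}"
      using A(2) gen_IF dom_gen by auto
    from generator_dom[OF A(1) this] obtain a where a: "a \<in> A" "dom a = {1..n} - {k}" by blast
    show "{1..n} - {k} \<in> dom ` A" by (rule image_eqI[of _ dom, OF a(2)[symmetric] a(1)])
  qed
  have inj: "inj_on (\<lambda>k. {1..n} - {k}) {0..n}"
  proof (rule inj_onI)
    fix k l assume kl: "k \<in> {0..n}" "l \<in> {0..n}" and eq: "{1..n} - {k} = {1..n} - {l}"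
    have "k \<notin> {1..n} - {l}" unfolding eq[symmetric] by simp
    then have "k = 0 \<or> k = l" using kl(1) by (cases k) simp_all
    moreover have "l \<notin> {1..n} - {k}" unfolding eq by simp
    then have "l = 0 \<or> l = k" using kl(2) by (cases l) simp_all
    ultimately show "k = l" by blast
  qed
  have "n + 1 = card ((\<lambda>k. {1..n} - {k}) ` {0..n})"
    unfolding card_image[OF inj] by simp
  also have "\<dots> \<le> card (dom ` A)"
    using finite_imageI[OF fin] sub by (rule card_mono)
  also have "\<dots> \<le> card A" using fin by (rule card_image_le)
  finally show ?thesis .
qed

end

theorem theorem4p4:
  fixes n :: nat
  assumes "n \<ge> 1" and "even n"
  shows "semigroup_rank pmult (IF n) = n + 1"
  unfolding semigroup_rank_def
proof (rule Least_equality)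
  interpret even_fence n using assms by unfold_locales
  have sub: "gen ` {0..n} \<subseteq> IF n" using gen_IF by auto
  \<comment> \<open>The lower bound, applied to the generators themselves, shows that they are
    pairwise distinct.\<close>
  have "card (gen ` {0..n}) = n + 1"
    using card_generating_set[OF sub S_eq] card_image_le[of "{0..n}" gen] by simp
  then show "\<exists>A. A \<subseteq> IF n \<and> finite A \<and> card A = n + 1 \<and> subsemigroup_gen pmult A = IF n"
    using sub S_eq by blast
  show "n + 1 \<le> k"
    if "\<exists>A. A \<subseteq> IF n \<and> finite A \<and> card A = k \<and> subsemigroup_gen pmult A = IF n" for k
    using that card_generating_set by blast
qed

end
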